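(* Let $r\le 1$, let $r^*\le 1$ be the optimal clean smooth rate (see the standing assumption in the context), write $Y^*:=Y^{\mathrm{GLS},r^*}$, and set $$\lambda_1:=\Big(e_0-\frac{r^*}{2}\Big)+(1-2e_0)\cdot\frac r2,\qquad \lambda_2:=e_\Delta\cdot(1-r),\qquad e_\Delta:=e_1-e_0 .$$ Then the risk minimization with respect to $\widetilde Y^{\mathrm{GLS},r}$ in the noisy setting, $$\min_{f\in\mathcal F}\ \mathbb{E}_{(X,\widetilde Y)\sim\widetilde{\mathcal D}}\big[\ell(\mathbf f(X),\widetilde Y^{\mathrm{GLS},r})\big],$$ is equivalent to the minimization of the risk with respect to $Y^*$ defined on the clean data, with two additional bias terms: $$\min_{f\in\mathcal F}\ \underbrace{\mathbb{E}_{(X,Y)\sim\mathcal D}\big[\ell(\mathbf f(X),Y^* )\big]}_{\text{true risk}}+\lambda_1\cdot\mathbb{E}_{(X,Y)\sim\mathcal D}\big[\ell(\mathbf f(X),1-Y)-\ell(\mathbf f(X),Y)\big]+\lambda_2\cdot\mathbb{E}_{X,Y=1}\big[\ell(\mathbf f(X),0)-\ell(\mathbf f(X),1)\big].$$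
   Context: Binary classification with label noise. $(X,Y)\sim\mathcal D$ with $X\in\mathcal X$ and clean label $Y\in\{0,1\}$. The noisy label $\widetilde Y\in\{0,1\}$ is conditionally independent of $X$ given $Y$, with $\mathbb P(\widetilde Y=1\mid Y=0)=e_0$ and $\mathbb P(\widetilde Y=0\mid Y=1)=e_1$, where without loss of generality $e_\Delta=e_1-e_0\ge 0$; $\widetilde{\mathcal D}$ is the law of $(X,\widetilde Y)$. A model $f$ assigns to each $x$ a probability vector $\mathbf f(x)=(\mathbf f(x)_0,\mathbf f(x)_1)$ (a softmax output); $\mathcal F$ is the hypothesis space of models under consideration. The loss is cross-entropy, $\ell(\mathbf f(x),y)=-\log \mathbf f(x)_y$ for $y\in\{0,1\}$, extended linearly to vector labels: $\ell(\mathbf f(x),\mathbf v)=-\sum_{k\in\{0,1\}} v_k\log\mathbf f(x)_k$ for $\mathbf v\in\mathbb R^2$. Generalized label smoothing: for a label $y$ with one-hot vector $\mathbf y\in\mathbb R^2$ and smooth rate $r\in(-\infty,1]$, the smoothed label is $\mathbf y^{\mathrm{GLS},r}=(1-r)\mathbf y+\frac r2\mathbf 1$, where $\mathbf 1$ is the all-ones vector (entries may be negative when $r<0$). $Y^{\mathrm{GLS},r}$ and $\widetilde Y^{\mathrm{GLS},r}$ denote the smoothed versions of $Y$ and $\widetilde Y$. Standing assumption defining $r^*$: learning with the clean data distribution $\mathcal D$ with smooth rate $r^*\le 1$ makes the corresponding classifier $f^*_{\mathcal D}\in\arg\min_{f\in\mathcal F}\mathbb{E}_{(X,Y)\sim\mathcal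 D}[\ell(\mathbf f(X),Y^{\mathrm{GLS},r^*})]$ return the best performance on the unseen clean test data distribution. Notation: $\mathbb{E}_{X,Y=1}[g(X)]:=\mathbb{E}_{(X,Y)\sim\mathcal D}\big[\mathbf 1\{Y=1\}\,g(X)\big]$ (not normalized by $\mathbb P(Y=1)$). *)

theory Defs
  imports "HOL-Probability.Probability"
begin

text \<open>
  Labels are elements of the two-element numeral type \<open>2\<close>, whose elements are \<open>0\<close> and \<open>1\<close> (arithmetic
  is modulo 2, so \<open>1 - y\<close> is the flipped label). Label vectors and model outputs live in
  \<open>real ^ 2\<close>, with components \<open>p $ 0\<close> and \<open>p $ 1\<close>.
\<close>

definition softmax :: "real ^ 2 \<Rightarrow> real ^ 2" where
  "softmax z = (\<chi> k. exp (z $ k) / (\<Sum>j\<in>UNIV. exp (z $ j)))"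

definition is_model :: "'x measure \<Rightarrow> ('x \<Rightarrow> real ^ 2) \<Rightarrow> bool" where
  "is_model MX f \<longleftrightarrow> f \<in> borel_measurable MX \<and> (\<forall>x\<in>space MX. f x \<in> range softmax)"

definition cross_entropy :: "real ^ 2 \<Rightarrow> 2 \<Rightarrow> real" where
  "cross_entropy p y = - ln (p $ y)"

definition cross_entropy_vec :: "real ^ 2 \<Rightarrow> real ^ 2 \<Rightarrow> real" where
  "cross_entropy_vec p v = - (\<Sum>k\<in>UNIV. v $ k * ln (p $ k))"

definition one_hot :: "2 \<Rightarrow> real ^ 2" where
  "one_hot y = axis y 1"

definition gls :: "real \<Rightarrow> 2 \<Rightarrow> real ^ 2" where
  "gls r y = (1 - r) *\<^sub>R one_hot y + (r / 2) *\<^sub>R 1"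

lemma softmax_pos: "softmax z $ k > 0"
  by (simp add: softmax_def sum_pos)

lemma sum_softmax: "(\<Sum>k\<in>UNIV. softmax z $ k) = 1"
proof -
  have "(\<Sum>j\<in>UNIV. exp (z $ j)) > 0"
    by (simp add: sum_pos)
  then show ?thesis
    by (simp add: softmax_def flip: sum_divide_distrib)
qed

lemma cross_entropy_vec_one_hot: "cross_entropy_vec p (one_hot y) = cross_entropy p y"
  by (simp add: cross_entropy_vec_def cross_entropy_def one_hot_def axis_def
      if_distrib[of "\<lambda>c. c * _"] cong: if_cong)

definition joint_law ::
  "'w measure \<Rightarrow> 'x measure \<Rightarrow> ('w \<Rightarrow> 'x) \<Rightarrow> ('w \<Rightarrow> 2) \<Rightarrow> ('x \<times> 2) measure" where
  "joint_law M MX X L = distr M (MX \<Otimes>\<^sub>M count_space UNIV) (\<lambda>\<omega>. (X \<omega>, L \<omega>))"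

definition gls_risk :: "('x \<times> 2) measure \<Rightarrow> real \<Rightarrow> ('x \<Rightarrow> real ^ 2) \<Rightarrow> real" where
  "gls_risk D r f = (\<integral>(x, y). cross_entropy_vec (f x) (gls r y) \<partial>D)"

text \<open>
  \<open>Z\<close> and \<open>X\<close> are conditionally independent given \<open>Y\<close>. Conditioning on an event \<open>Y = y\<close> of
  probability zero imposes nothing, since \<open>cond_prob\<close> is then \<open>0\<close> on both sides.
\<close>

definition cond_indep_given ::
  "'w measure \<Rightarrow> 'x measure \<Rightarrow> ('w \<Rightarrow> 2) \<Rightarrow> ('w \<Rightarrow> 'x) \<Rightarrow> ('w \<Rightarrow> 2) \<Rightarrow> bool" where
  "cond_indep_given M MX Z X Y \<longleftrightarrow>
    (\<forall>A\<in>sets MX. \<forall>k y.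
      \<P>(\<omega> in M. X \<omega> \<in> A \<and> Z \<omega> = k \<bar> Y \<omega> = y) =
      \<P>(\<omega> in M. X \<omega> \<in> A \<bar> Y \<omega> = y) * \<P>(\<omega> in M. Z \<omega> = k \<bar> Y \<omega> = y))"

text \<open>
  Error rates. A conditional probability is only prescribed when the conditioning event has
  positive probability.
\<close>

definition label_noise_rates ::
  "'w measure \<Rightarrow> ('w \<Rightarrow> 2) \<Rightarrow> ('w \<Rightarrow> 2) \<Rightarrow> real \<Rightarrow> real \<Rightarrow> bool" where
  "label_noise_rates M Y Z e0 e1 \<longleftrightarrow>
    (\<P>(\<omega> in M. Y \<omega> = 0) > 0 \<longrightarrow> \<P>(\<omega> in M. Z \<omega> = 1 \<bar> Y \<omega> = 0) = e0) \<and>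
    (\<P>(\<omega> in M. Y \<omega> = 1) > 0 \<longrightarrow> \<P>(\<omega> in M. Z \<omega> = 0 \<bar> Y \<omega> = 1) = e1)"

text \<open>
  Optimality of a clean smooth rate. The performance measure on the (clean) test distribution is a
  parameter \<open>perf\<close>, larger values being better (e.g.\ test accuracy): some risk minimizer for the
  rate \<open>rs\<close> performs at least as well as every risk minimizer for every other admissible rate.
\<close>

definition optimal_smooth_rate ::
  "(('x \<times> 2) measure \<Rightarrow> ('x \<Rightarrow> real ^ 2) \<Rightarrow> real) \<Rightarrow> ('x \<times> 2) measure \<Rightarrow>
    ('x \<Rightarrow> real ^ 2) set \<Rightarrow> real \<Rightarrow> bool" where
  "optimal_smooth_rate perf D F rs \<longleftrightarrow> rs \<le> 1 \<and>
    (\<exists>fs. is_arg_min (gls_risk D rs) (\<lambda>f. f \<in> F) fs \<and>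
      (\<forall>r\<le>1. \<forall>g. is_arg_min (gls_risk D r) (\<lambda>f. f \<in> F) g \<longrightarrow> perf D g \<le> perf D fs))"

definition biased_clean_risk ::
  "('x \<times> 2) measure \<Rightarrow> real \<Rightarrow> real \<Rightarrow> real \<Rightarrow> ('x \<Rightarrow> real ^ 2) \<Rightarrow> real" where
  "biased_clean_risk D rs l1 l2 f =
    gls_risk D rs f
    + l1 * (\<integral>(x, y). cross_entropy (f x) (1 - y) - cross_entropy (f x) y \<partial>D)
    + l2 * (\<integral>(x, y). indicator {1} y * (cross_entropy (f x) 0 - cross_entropy (f x) 1) \<partial>D)"

end

theory Submission
  imports Defs
begin

text \<open>
  Conditionally on \<open>Y\<close>, the noisy label is independent of \<open>X\<close>, so integrating it out replaces the
  smoothed loss at the noisy label by its mixture over the labels \<open>0\<close>, \<open>1\<close> with weights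
  \<open>1 - e0\<close>, \<open>e0\<close> (if \<open>Y = 0\<close>) or
  \<open>e1\<close>, \<open>1 - e1\<close> (if \<open>Y = 1\<close>). The mixture is an affine combination of the two cross-entropies,
  and \<open>lam1\<close> and \<open>lam2\<close> are the coefficients for which it agrees pointwise, for each value of
  \<open>Y\<close>, with the integrand of the biased clean risk; hence the two objectives coincide on \<open>F\<close>.
\<close>

section \<open>Two-valued labels and the passage from joint laws to the sample space\<close>

lemma exhaust_2_01: "(k::2) = 0 \<or> k = 1"
  using exhaust_2[of k] by auto

lemma UNIV_2_01: "(UNIV::2 set) = {0, 1}"
  using exhaust_2_01 by auto

lemma sum_2_01: "(\<Sum>k\<in>(UNIV::2 set). g k) = g 0 + (g 1 :: 'a::comm_monoid_add)"
  by (simp add: UNIV_2_01)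

lemma borel_measurable_cross_entropy:
  assumes "is_model MX f"
  shows "(\<lambda>x. cross_entropy (f x) k) \<in> borel_measurable MX"
proof -
  have [measurable]: "f \<in> borel_measurable MX"
    using assms by (simp add: is_model_def)
  \<comment> \<open>Component \<open>k\<close> is the inner product with a basis vector, so its
    measurability follows from that of the inner product.\<close>
  have "(\<lambda>x. f x \<bullet> axis k 1) \<in> borel_measurable MX" by measurable
  then have [measurable]: "(\<lambda>x. f x $ k) \<in> borel_measurable MX" by (simp add: inner_axis)
  show ?thesis unfolding cross_entropy_def by measurable
qed

text \<open>The second factor is discrete with two points, so the function is a sum of its two
  sections weighted by label indicators.\<close>

lemma borel_measurable_pair_2:
  fixes h :: "'x \<Rightarrow> 2 \<Rightarrow> real"
  assumes [measurable]: "\<And>k. (\<lambda>x. h x k) \<in> borel_measurable MX"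
  shows "(\<lambda>(x, y). h x y) \<in> borel_measurable (MX \<Otimes>\<^sub>M count_space UNIV)"
proof -
  have "(\<lambda>(x, y). h x y) = (\<lambda>p. indicator {0} (snd p) * h (fst p) 0 + indicator {1} (snd p) * h (fst p) 1)"
    using exhaust_2_01 by (fastforce simp: indicator_def)
  then show ?thesis by simp
qed

text \<open>Each joint law records only one of the labels, whereas conditional independence relates
  both; the risks are therefore moved to \<open>M\<close>, where both labels live.\<close>

lemma
  fixes h :: "'x \<Rightarrow> 2 \<Rightarrow> real"
  assumes [measurable]: "X \<in> measurable M MX" "L \<in> measurable M (count_space UNIV)"
    and "\<And>k. (\<lambda>x. h x k) \<in> borel_measurable MX"
  shows integral_joint_law: "(\<integral>(x, y). h x y \<partial>joint_law M MX X L) = (\<integral>\<omega>. h (X \<omega>) (L \<omega>) \<partial>M)"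
    and integrable_joint_law:
      "integrable (joint_law M MX X L) (\<lambda>(x, y). h x y) \<longleftrightarrow> integrable M (\<lambda>\<omega>. h (X \<omega>) (L \<omega>))"
proof -
  note [measurable] = borel_measurable_pair_2[of h MX, OF assms(3)]
  have [measurable]: "(\<lambda>\<omega>. (X \<omega>, L \<omega>)) \<in> measurable M (MX \<Otimes>\<^sub>M count_space UNIV)" by measurable
  show "(\<integral>(x, y). h x y \<partial>joint_law M MX X L) = (\<integral>\<omega>. h (X \<omega>) (L \<omega>) \<partial>M)"
    unfolding joint_law_def by (subst integral_distr) simp_all
  show "integrable (joint_law M MX X L) (\<lambda>(x, y). h x y) \<longleftrightarrow> integrable M (\<lambda>\<omega>. h (X \<omega>) (L \<omega>))"
    unfolding joint_law_def by (subst integrable_distr_eq) simp_all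
qed

text \<open>The vector loss is linear in the label, and the all-ones vector contributes both
  cross-entropies equally. Every smoothed risk thus reduces to two functions of
  \<open>x\<close>.\<close>

lemma cross_entropy_vec_gls:
  "cross_entropy_vec p (gls r y) =
    (1 - r) * cross_entropy p y + r / 2 * (cross_entropy p 0 + cross_entropy p 1)"
  using exhaust_2_01[of y]
  by (auto simp: cross_entropy_vec_def gls_def one_hot_def axis_def cross_entropy_def sum_2_01
      algebra_simps)

section \<open>Integrating out the noisy label\<close>

context prob_space
begin

text \<open>Conditional independence speaks of sets; it makes two finite measures on
  \<open>MX\<close> proportional. Comparing measures instead of integrals covers every measurable
  \<open>g\<close> at once, integrable or not.\<close>

lemma integral_cond_indep_given:
  fixes g :: "'x \<Rightarrow> real"
  assumes [measurable]: "X \<in> measurable M MX" "Y \<in> measurable M (count_space UNIV)"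
      "Z \<in> measurable M (count_space UNIV)" "g \<in> borel_measurable MX"
    and ci: "cond_indep_given M MX Z X Y"
  shows "(\<integral>\<omega>. indicator {\<omega>. Y \<omega> = y \<and> Z \<omega> = k} \<omega> * g (X \<omega>) \<partial>M) =
    \<P>(\<omega> in M. Z \<omega> = k \<bar> Y \<omega> = y) * (\<integral>\<omega>. indicator {\<omega>. Y \<omega> = y} \<omega> * g (X \<omega>) \<partial>M)"
proof -
  define c where "c = \<P>(\<omega> in M. Z \<omega> = k \<bar> Y \<omega> = y)"
  have c: "c \<ge> 0" by (simp add: c_def cond_prob_def)
  \<comment> \<open>\<open>N P\<close> is the unnormalised law of \<open>X\<close> on the event
    \<open>P\<close>; its total mass is the probability of \<open>P\<close>.\<close>
  define N where "N P = distr (density M (\<lambda>\<omega>. ennreal (indicator {\<omega>. P \<omega>} \<omega>))) MX X" for P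
  have em: "emeasure (N P) A = ennreal (\<P>(\<omega> in M. X \<omega> \<in> A \<and> P \<omega>))"
    if [measurable]: "A \<in> sets MX" "Measurable.pred M P" for P A
  proof -
    have "emeasure (N P) A = (\<integral>\<^sup>+\<omega>. ennreal (indicator {\<omega>. P \<omega>} \<omega>) * indicator (X -` A \<inter> space M) \<omega> \<partial>M)"
      unfolding N_def by (simp add: emeasure_distr emeasure_density)
    also have "\<dots> = (\<integral>\<^sup>+\<omega>. indicator {\<omega> \<in> space M. X \<omega> \<in> A \<and> P \<omega>} \<omega> \<partial>M)"
      by (intro nn_integral_cong) (auto simp: indicator_def)
    finally show ?thesis by (simp add: emeasure_eq_measure)
  qed
  have int: "(\<integral>x. g x \<partial>N P) = (\<integral>\<omega>. indicator {\<omega>. P \<omega>} \<omega> * g (X \<omega>) \<partial>M)"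
    if [measurable]: "Measurable.pred M P" for P
    unfolding N_def by (simp add: integral_distr integral_density)
  have joint: "\<P>(\<omega> in M. X \<omega> \<in> A \<and> Y \<omega> = y \<and> Z \<omega> = k) = c * \<P>(\<omega> in M. X \<omega> \<in> A \<and> Y \<omega> = y)"
    if [measurable]: "A \<in> sets MX" for A
  proof (cases "\<P>(\<omega> in M. Y \<omega> = y) = 0")
    \<comment> \<open>Conditioning on a null event gives the default value 0 and no information, but
      both joint probabilities vanish by monotonicity.\<close>
    case True
    have "\<P>(\<omega> in M. X \<omega> \<in> A \<and> Y \<omega> = y \<and> Z \<omega> = k) \<le> \<P>(\<omega> in M. Y \<omega> = y)"
      and "\<P>(\<omega> in M. X \<omega> \<in> A \<and> Y \<omega> = y) \<le> \<P>(\<omega> in M. Y \<omega> = y)"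
      by (auto intro!: finite_measure_mono)
    with True show ?thesis by (simp add: measure_le_0_iff)
  next
    case False
    have "\<P>(\<omega> in M. X \<omega> \<in> A \<and> Z \<omega> = k \<bar> Y \<omega> = y) = \<P>(\<omega> in M. X \<omega> \<in> A \<bar> Y \<omega> = y) * c"
      using ci that unfolding cond_indep_given_def c_def by blast
    with False show ?thesis
      by (simp add: cond_prob_def field_simps conj_commute conj_left_commute)
  qed
  have "N (\<lambda>\<omega>. Y \<omega> = y \<and> Z \<omega> = k) = density (N (\<lambda>\<omega>. Y \<omega> = y)) (\<lambda>_. ennreal c)"
  proof (rule measure_eqI)
    fix A assume "A \<in> sets (N (\<lambda>\<omega>. Y \<omega> = y \<and> Z \<omega> = k))"
    then have A: "A \<in> sets MX" by (simp add: N_def)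
    then have "A \<in> sets (N (\<lambda>\<omega>. Y \<omega> = y))" by (simp add: N_def)
    with A c show "emeasure (N (\<lambda>\<omega>. Y \<omega> = y \<and> Z \<omega> = k)) A =
        emeasure (density (N (\<lambda>\<omega>. Y \<omega> = y)) (\<lambda>_. ennreal c)) A"
      by (simp add: emeasure_density_const em joint ennreal_mult)
  qed (simp add: N_def)
  moreover have "g \<in> borel_measurable (N (\<lambda>\<omega>. Y \<omega> = y))" by (simp add: N_def)
  ultimately have "(\<integral>x. g x \<partial>N (\<lambda>\<omega>. Y \<omega> = y \<and> Z \<omega> = k)) = c * (\<integral>x. g x \<partial>N (\<lambda>\<omega>. Y \<omega> = y))"
    using c by (simp add: integral_density)
  then show ?thesis by (simp add: int c_def)
qed

lemma integral_indicator_eq_null: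
  fixes g :: "'a \<Rightarrow> real"
  assumes [measurable]: "Measurable.pred M P" and "\<P>(\<omega> in M. P \<omega>) = 0"
  shows "(\<integral>\<omega>. indicator {\<omega>. P \<omega>} \<omega> * g \<omega> \<partial>M) = 0"
proof -
  have "AE \<omega> in M. \<not> P \<omega>"
    using assms(2) by (subst AE_iff_measurable[OF _ refl]) (simp_all add: emeasure_eq_measure)
  then have "AE \<omega> in M. indicator {\<omega>. P \<omega>} \<omega> * g \<omega> = 0"
    by eventually_elim simp
  then show ?thesis by (rule integral_eq_zero_AE)
qed

text \<open>The noise rates prescribe only the flip probabilities; this supplies the probability of
  keeping the label.\<close>

lemma cond_prob_2_sum:
  fixes Z :: "'a \<Rightarrow> 2"
  assumes [measurable]: "Measurable.pred M P" "Z \<in> measurable M (count_space UNIV)"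
    and "\<P>(\<omega> in M. P \<omega>) \<noteq> 0"
  shows "\<P>(\<omega> in M. Z \<omega> = 0 \<bar> P \<omega>) + \<P>(\<omega> in M. Z \<omega> = 1 \<bar> P \<omega>) = 1"
proof -
  have "{\<omega> \<in> space M. P \<omega>} = {\<omega> \<in> space M. Z \<omega> = 0 \<and> P \<omega>} \<union> {\<omega> \<in> space M. Z \<omega> = 1 \<and> P \<omega>}"
    using exhaust_2_01 by blast
  then have "\<P>(\<omega> in M. P \<omega>) = \<P>(\<omega> in M. Z \<omega> = 0 \<and> P \<omega>) + \<P>(\<omega> in M. Z \<omega> = 1 \<and> P \<omega>)"
    by (simp only:) (subst finite_measure_Union; auto)
  with assms(3) show ?thesis by (simp add: cond_prob_def flip: add_divide_distrib)
qed

text \<open>The integral splits over the four values of the pair of labels, and on each piece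
  conditional independence turns the noisy label into a constant factor.\<close>

lemma integral_noisy_label:
  fixes h :: "'x \<Rightarrow> 2 \<Rightarrow> real"
  assumes [measurable]: "X \<in> measurable M MX" "Y \<in> measurable M (count_space UNIV)"
      "Z \<in> measurable M (count_space UNIV)" "\<And>k. (\<lambda>x. h x k) \<in> borel_measurable MX"
    and int: "\<And>k. integrable M (\<lambda>\<omega>. h (X \<omega>) k)"
    and ci: "cond_indep_given M MX Z X Y"
    and rates: "label_noise_rates M Y Z e0 e1"
  shows "(\<integral>\<omega>. h (X \<omega>) (Z \<omega>) \<partial>M) =
    (\<integral>\<omega>. indicator {\<omega>. Y \<omega> = 0} \<omega> * ((1 - e0) * h (X \<omega>) 0 + e0 * h (X \<omega>) 1)
      + indicator {\<omega>. Y \<omega> = 1} \<omega> * (e1 * h (X \<omega>) 0 + (1 - e1) * h (X \<omega>) 1) \<partial>M)"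
proof -
  \<comment> \<open>In \<open>I y k\<close> only the clean label is fixed, while the integrand is
    taken at the noisy value \<open>k\<close>.\<close>
  define I where "I y k = (\<integral>\<omega>. indicator {\<omega>. Y \<omega> = y} \<omega> * h (X \<omega>) k \<partial>M)" for y k
  define J where "J y k = (\<integral>\<omega>. indicator {\<omega>. Y \<omega> = y \<and> Z \<omega> = k} \<omega> * h (X \<omega>) k \<partial>M)" for y k
  have int_ind: "integrable M (\<lambda>\<omega>. indicator {\<omega>. P \<omega>} \<omega> * h (X \<omega>) k)"
    if [measurable]: "Measurable.pred M P" for P k
    by (rule Bochner_Integration.integrable_bound[OF int[of k]]) (auto simp: indicator_def)
  have J: "J y k = \<P>(\<omega> in M. Z \<omega> = k \<bar> Y \<omega> = y) * I y k" for y k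
    unfolding I_def J_def by (rule integral_cond_indep_given[OF assms(1-4) ci])
  have I0: "I y k = 0" if "\<P>(\<omega> in M. Y \<omega> = y) = 0" for y k
    unfolding I_def using that by (intro integral_indicator_eq_null) simp_all
  have sum1: "\<P>(\<omega> in M. Z \<omega> = 0 \<bar> Y \<omega> = y) + \<P>(\<omega> in M. Z \<omega> = 1 \<bar> Y \<omega> = y) = 1"
    if "\<P>(\<omega> in M. Y \<omega> = y) \<noteq> 0" for y
    using that by (intro cond_prob_2_sum) simp_all
  \<comment> \<open>If \<open>Y = 0\<close> has probability zero, \<open>e0\<close> is
    unconstrained, but \<open>I\<close> and \<open>J\<close> vanish there, so any weights fit. The
    same goes for \<open>e1\<close> below.\<close>
  have J0: "J 0 0 = (1 - e0) * I 0 0 \<and> J 0 1 = e0 * I 0 1"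
  proof (cases "\<P>(\<omega> in M. Y \<omega> = 0) = 0")
    case False
    then have "\<P>(\<omega> in M. Z \<omega> = 1 \<bar> Y \<omega> = 0) = e0"
      using rates by (simp add: label_noise_rates_def zero_less_measure_iff)
    with sum1[OF False] show ?thesis by (simp add: J eq_diff_eq)
  qed (simp add: J I0)
  have J1: "J 1 0 = e1 * I 1 0 \<and> J 1 1 = (1 - e1) * I 1 1"
  proof (cases "\<P>(\<omega> in M. Y \<omega> = 1) = 0")
    case False
    then have "\<P>(\<omega> in M. Z \<omega> = 0 \<bar> Y \<omega> = 1) = e1"
      using rates by (simp add: label_noise_rates_def zero_less_measure_iff)
    with sum1[OF False] show ?thesis by (simp add: J eq_diff_eq add.commute)
  qed (simp add: J I0)
  have "h (X \<omega>) (Z \<omega>) = indicator {\<omega>. Y \<omega> = 0 \<and> Z \<omega> = 0} \<omega> * h (X \<omega>) 0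
      + indicator {\<omega>. Y \<omega> = 0 \<and> Z \<omega> = 1} \<omega> * h (X \<omega>) 1
      + indicator {\<omega>. Y \<omega> = 1 \<and> Z \<omega> = 0} \<omega> * h (X \<omega>) 0
      + indicator {\<omega>. Y \<omega> = 1 \<and> Z \<omega> = 1} \<omega> * h (X \<omega>) 1" for \<omega>
    using exhaust_2_01[of "Y \<omega>"] exhaust_2_01[of "Z \<omega>"] by auto
  then have "(\<integral>\<omega>. h (X \<omega>) (Z \<omega>) \<partial>M) = J 0 0 + J 0 1 + J 1 0 + J 1 1"
    by (simp add: J_def int_ind)
  also have "\<dots> = (1 - e0) * I 0 0 + e0 * I 0 1 + (e1 * I 1 0 + (1 - e1) * I 1 1)"
    using J0 J1 by simp
  also have "\<dots> = (\<integral>\<omega>. (1 - e0) * (indicator {\<omega>. Y \<omega> = 0} \<omega> * h (X \<omega>) 0)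
      + e0 * (indicator {\<omega>. Y \<omega> = 0} \<omega> * h (X \<omega>) 1)
      + (e1 * (indicator {\<omega>. Y \<omega> = 1} \<omega> * h (X \<omega>) 0)
      + (1 - e1) * (indicator {\<omega>. Y \<omega> = 1} \<omega> * h (X \<omega>) 1)) \<partial>M)"
    by (simp add: I_def int_ind)
  also have "\<dots> = (\<integral>\<omega>. indicator {\<omega>. Y \<omega> = 0} \<omega> * ((1 - e0) * h (X \<omega>) 0 + e0 * h (X \<omega>) 1)
      + indicator {\<omega>. Y \<omega> = 1} \<omega> * (e1 * h (X \<omega>) 0 + (1 - e1) * h (X \<omega>) 1) \<partial>M)"
    by (intro Bochner_Integration.integral_cong refl) (simp add: algebra_simps)
  finally show ?thesis .
qed

end

section \<open>Equality of the two objectives for a single model\<close>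

lemma gls_risk_noisy_eq_biased_clean_risk:
  assumes "prob_space M"
    and [measurable]: "X \<in> measurable M MX" "Y \<in> measurable M (count_space UNIV)"
      "Yn \<in> measurable M (count_space UNIV)"
    and ci: "cond_indep_given M MX Yn X Y"
    and rates: "label_noise_rates M Y Yn e0 e1"
    and model: "is_model MX f"
    and int: "\<And>k. integrable (joint_law M MX X Y) (\<lambda>(x, y). cross_entropy (f x) k)"
  shows "gls_risk (joint_law M MX X Yn) r f =
    biased_clean_risk (joint_law M MX X Y) rs
      ((e0 - rs / 2) + (1 - 2 * e0) * (r / 2)) ((e1 - e0) * (1 - r)) f"
proof -
  interpret prob_space M by fact
  note [measurable] = borel_measurable_cross_entropy[OF model]
  let ?l = "\<lambda>\<omega> k. cross_entropy (f (X \<omega>)) k"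
  have il: "integrable M (\<lambda>\<omega>. ?l \<omega> k)" for k
    using int[of k] by (subst (asm) integrable_joint_law) simp_all
  \<comment> \<open>Integrability at each fixed label passes to the random label \<open>Y\<close>;
    this allows the final integral to be split into the risk and its two bias terms.\<close>
  have iY: "integrable M (\<lambda>\<omega>. h (X \<omega>) (Y \<omega>))"
    if "\<And>k. integrable M (\<lambda>\<omega>. h (X \<omega>) k)" for h :: "'b \<Rightarrow> 2 \<Rightarrow> real"
  proof -
    have "integrable M (\<lambda>\<omega>. indicator {\<omega>. Y \<omega> = k} \<omega> * h (X \<omega>) k)" for k
      by (rule Bochner_Integration.integrable_bound[OF that[of k]])
        (use that[of k] in \<open>auto simp: indicator_def\<close>)
    moreover have "h (X \<omega>) (Y \<omega>) = indicator {\<omega>. Y \<omega> = 0} \<omega> * h (X \<omega>) 0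
        + indicator {\<omega>. Y \<omega> = 1} \<omega> * h (X \<omega>) 1" for \<omega>
      using exhaust_2_01[of "Y \<omega>"] by auto
    ultimately show ?thesis by simp
  qed
  let ?G = "\<lambda>x y. cross_entropy_vec (f x) (gls rs y)"
  let ?B = "\<lambda>x y. cross_entropy (f x) (1 - y) - cross_entropy (f x) y"
  let ?C = "\<lambda>x y. indicator {1::2} y * (cross_entropy (f x) 0 - cross_entropy (f x) 1)"
  let ?l1 = "(e0 - rs / 2) + (1 - 2 * e0) * (r / 2)" and ?l2 = "(e1 - e0) * (1 - r)"
  have iGBC: "integrable M (\<lambda>\<omega>. ?G (X \<omega>) (Y \<omega>))" "integrable M (\<lambda>\<omega>. ?B (X \<omega>) (Y \<omega>))"
    "integrable M (\<lambda>\<omega>. ?C (X \<omega>) (Y \<omega>))"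
    by (rule iY, simp add: cross_entropy_vec_gls il)+
  have "gls_risk (joint_law M MX X Yn) r f = (\<integral>\<omega>. cross_entropy_vec (f (X \<omega>)) (gls r (Yn \<omega>)) \<partial>M)"
    unfolding gls_risk_def by (rule integral_joint_law) (simp_all add: cross_entropy_vec_gls)
  also have "\<dots> = (\<integral>\<omega>. indicator {\<omega>. Y \<omega> = 0} \<omega> * ((1 - e0) * cross_entropy_vec (f (X \<omega>)) (gls r 0)
        + e0 * cross_entropy_vec (f (X \<omega>)) (gls r 1))
      + indicator {\<omega>. Y \<omega> = 1} \<omega> * (e1 * cross_entropy_vec (f (X \<omega>)) (gls r 0)
        + (1 - e1) * cross_entropy_vec (f (X \<omega>)) (gls r 1)) \<partial>M)"
    by (rule integral_noisy_label[OF _ _ _ _ _ ci rates]) (simp_all add: cross_entropy_vec_gls il)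
  \<comment> \<open>For \<open>Y = 0\<close> the mixture gives the opposite label weight
    \<open>e0 + (1 - 2 * e0) * (r / 2)\<close>. As \<open>?G\<close> already gives it
    \<open>rs / 2\<close>, the coefficient \<open>?l1\<close> is the difference. For
    \<open>Y = 1\<close> the weight has \<open>e1\<close> in place of \<open>e0\<close>, and the
    surplus \<open>(e1 - e0) * (1 - r)\<close> is \<open>?l2\<close>.\<close>
  also have "\<dots> = (\<integral>\<omega>. ?G (X \<omega>) (Y \<omega>) + ?l1 * ?B (X \<omega>) (Y \<omega>) + ?l2 * ?C (X \<omega>) (Y \<omega>) \<partial>M)"
  proof (intro Bochner_Integration.integral_cong refl)
    fix \<omega>
    consider "Y \<omega> = 0" | "Y \<omega> = 1" using exhaust_2_01 by blast
    then show "indicator {\<omega>. Y \<omega> = 0} \<omega> * ((1 - e0) * cross_entropy_vec (f (X \<omega>)) (gls r 0)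
        + e0 * cross_entropy_vec (f (X \<omega>)) (gls r 1))
      + indicator {\<omega>. Y \<omega> = 1} \<omega> * (e1 * cross_entropy_vec (f (X \<omega>)) (gls r 0)
        + (1 - e1) * cross_entropy_vec (f (X \<omega>)) (gls r 1))
      = ?G (X \<omega>) (Y \<omega>) + ?l1 * ?B (X \<omega>) (Y \<omega>) + ?l2 * ?C (X \<omega>) (Y \<omega>)"
      by cases (simp_all add: cross_entropy_vec_gls field_simps)
  qed
  also have "\<dots> = (\<integral>\<omega>. ?G (X \<omega>) (Y \<omega>) \<partial>M) + ?l1 * (\<integral>\<omega>. ?B (X \<omega>) (Y \<omega>) \<partial>M)
      + ?l2 * (\<integral>\<omega>. ?C (X \<omega>) (Y \<omega>) \<partial>M)"
    using iGBC by simp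
  also have "\<dots> = biased_clean_risk (joint_law M MX X Y) rs ?l1 ?l2 f"
    unfolding biased_clean_risk_def gls_risk_def
    by (subst (1 2 3) integral_joint_law) (simp_all add: cross_entropy_vec_gls)
  finally show ?thesis .
qed

theorem theorem3p2:
  fixes M :: "'w measure" and MX :: "'x measure"
    and X :: "'w \<Rightarrow> 'x" and Y Yn :: "'w \<Rightarrow> 2"
    and D Dn :: "('x \<times> 2) measure"
    and F :: "('x \<Rightarrow> real ^ 2) set"
    and perf :: "('x \<times> 2) measure \<Rightarrow> ('x \<Rightarrow> real ^ 2) \<Rightarrow> real"
    and e0 e1 e\<Delta> r rs lam1 lam2 :: real
  assumes "prob_space M"
    and "X \<in> measurable M MX"
    and "Y \<in> measurable M (count_space UNIV)"
    and "Yn \<in> measurable M (count_space UNIV)"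
    and "D = joint_law M MX X Y"
    and "Dn = joint_law M MX X Yn"
    and "cond_indep_given M MX Yn X Y"
    and "label_noise_rates M Y Yn e0 e1"
    and "e\<Delta> = e1 - e0" and "e\<Delta> \<ge> 0"
    and "\<And>f. f \<in> F \<Longrightarrow> is_model MX f"
    and "\<And>f k. f \<in> F \<Longrightarrow> integrable D (\<lambda>(x, y). cross_entropy (f x) k)"
    and "r \<le> 1"
    and "optimal_smooth_rate perf D F rs"
    and "lam1 = (e0 - rs / 2) + (1 - 2 * e0) * (r / 2)"
    and "lam2 = e\<Delta> * (1 - r)"
  shows "(\<forall>f\<in>F. gls_risk Dn r f = biased_clean_risk D rs lam1 lam2 f) \<and>
    (\<forall>f. is_arg_min (gls_risk Dn r) (\<lambda>g. g \<in> F) f \<longleftrightarrow>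
         is_arg_min (biased_clean_risk D rs lam1 lam2) (\<lambda>g. g \<in> F) f)"
proof -
  have eq: "gls_risk Dn r f = biased_clean_risk D rs lam1 lam2 f" if "f \<in> F" for f
    using gls_risk_noisy_eq_biased_clean_risk[OF assms(1-4,7,8) assms(11)[OF that]]
      assms(12)[OF that] unfolding assms(5,6,9,15,16) by blast
  \<comment> \<open>\<open>is_arg_min\<close> compares values only at members of \<open>F\<close>,
    where the objectives agree.\<close>
  then show ?thesis by (auto simp: is_arg_min_def)
qed

end
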